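(* For all positive integers $k$, $t$, $s$, $r$ and $n$ satisfying $\max(t+1,s)\le k\le n$, $$M(n,r,k,t,s) \ge r^{-s/(k-t)} \binom{n}{s}.$$
   Context: $K_n^k$ denotes the complete $k$-uniform hypergraph on a vertex set $V_n$ of size $n$, where $n\ge k\ge 2$ (its edges are all $k$-subsets of $V_n$). Hypergraphs are identified with their edge sets. For a hypergraph or edge set $H$ and a positive integer $s$, the $s$-shadow is $E^{(s)}(H)=\{S : |S|=s,\ \exists e\in H: S\subseteq e\}$. For a hypergraph $H$, the $t$-tight components of $H$ are the classes of the partition of the edges of $H$ obtained by starting from singletons (one per edge) and iteratively merging two classes whenever one contains an edge $e$ and the other an edge $f$ with $|e\cap f|\ge t$, until no further merging is possible; $TC_t(H)$ is the family of these edge sets. $\mathrm{Col}_r(H)$ is the family of all (not necessarily proper) colorings of the edges of $H$ with colors $1,\dots,r$ (not all colors need be used). For $\mathbf{c}\in \mathrm{Col}_r(K_n^k)$ let $H_i=H_i(\mathbf{c})$ be the $k$-uniform hypergraph of all edges of color $i$, and define $$M(n,r,k,t,s;\mathbf{c})=\max_{i\in\{1,\dots,r\}}\ \max_{C\in TC_t(H_i)}|E^{(s)}(C)|$$ (color classes with no edges are ignored), and $M(n,r,k,t,s)=\min_{\mathbf{c}\in \mathrm{Col}_r(K_n^k)} M(n,r,k,t,s;\mathbf{c})$. *)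

theory Defs
  imports Complex_Main "HOL-Library.FuncSet" "HOL-Library.Disjoint_Sets"
begin

definition complete_hypergraph :: "nat \<Rightarrow> nat \<Rightarrow> nat set set" where
  "complete_hypergraph n k = {e. e \<subseteq> {1..n} \<and> card e = k}"

definition shadow :: "nat \<Rightarrow> 'a set set \<Rightarrow> 'a set set" where
  "shadow s H = {S. card S = s \<and> (\<exists>e\<in>H. S \<subseteq> e)}"

definition tight_merge :: "nat \<Rightarrow> 'a set set set \<Rightarrow> 'a set set set \<Rightarrow> bool" where
  "tight_merge t P Q \<longleftrightarrow>
     (\<exists>A\<in>P. \<exists>B\<in>P. A \<noteq> B \<and> (\<exists>e\<in>A. \<exists>f\<in>B. card (e \<inter> f) \<ge> t) \<and>
        Q = insert (A \<union> B) (P - {A, B}))"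

definition tight_merge_result :: "nat \<Rightarrow> 'a set set \<Rightarrow> 'a set set set \<Rightarrow> bool" where
  "tight_merge_result t H P \<longleftrightarrow>
     (tight_merge t)\<^sup>*\<^sup>* ((\<lambda>e. {e}) ` H) P \<and> \<not> (\<exists>Q. tight_merge t P Q)"

(* For finite H every maximal sequence of merges ends in the same partition, so the definite
   description is meaningful: see tight_merge_result_unique below. *)
definition tight_components :: "nat \<Rightarrow> 'a set set \<Rightarrow> 'a set set set" where
  "tight_components t H = (THE P. tight_merge_result t H P)"

definition edge_colorings :: "nat \<Rightarrow> 'a set set \<Rightarrow> ('a set \<Rightarrow> nat) set" where
  "edge_colorings r H = (H \<rightarrow>\<^sub>E {1..r})"

definition color_class :: "'a set set \<Rightarrow> ('a set \<Rightarrow> nat) \<Rightarrow> nat \<Rightarrow> 'a set set" where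
  "color_class H c i = {e \<in> H. c e = i}"

(* The indices of the maxima and of the minimum below range over finite sets; these are nonempty
   when 1 <= r and k <= n, where c is an edge coloring with colors 1, ..., r. *)
definition M_coloring :: "nat \<Rightarrow> nat \<Rightarrow> nat \<Rightarrow> nat \<Rightarrow> nat \<Rightarrow> (nat set \<Rightarrow> nat) \<Rightarrow> nat" where
  "M_coloring n r k t s c =
     (MAX i \<in> {i \<in> {1..r}. color_class (complete_hypergraph n k) c i \<noteq> {}}.
        MAX C \<in> tight_components t (color_class (complete_hypergraph n k) c i).
          card (shadow s C))"

definition M_min :: "nat \<Rightarrow> nat \<Rightarrow> nat \<Rightarrow> nat \<Rightarrow> nat \<Rightarrow> nat" where
  "M_min n r k t s =
     (MIN c \<in> edge_colorings r (complete_hypergraph n k). M_coloring n r k t s c)"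

definition tight_rel :: "nat \<Rightarrow> 'a set set \<Rightarrow> 'a set rel" where
  "tight_rel t H = {(e, f). e \<in> H \<and> f \<in> H \<and> card (e \<inter> f) \<ge> t}"

definition tight_equiv :: "nat \<Rightarrow> 'a set set \<Rightarrow> 'a set rel" where
  "tight_equiv t H = {(e, f). e \<in> H \<and> f \<in> H \<and> (e, f) \<in> (tight_rel t H)\<^sup>*}"

lemma sym_tight_rel: "sym (tight_rel t H)"
  by (auto simp: sym_def tight_rel_def Int_commute)

lemma equiv_tight_equiv: "equiv H (tight_equiv t H)"
  using sym_rtrancl[OF sym_tight_rel[of t H]]
  by (auto intro!: equivI simp: refl_on_def sym_def trans_def tight_equiv_def)

lemma tight_merge_invariant:
  assumes "(tight_merge t)\<^sup>*\<^sup>* ((\<lambda>e. {e}) ` H) P"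
  shows "partition_on H P \<and> (\<forall>A\<in>P. \<forall>e\<in>A. \<forall>f\<in>A. (e, f) \<in> (tight_rel t H)\<^sup>*)"
  using assms
proof (induction rule: rtranclp_induct)
  case base
  show ?case by (auto simp: partition_on_def disjoint_def)
next
  case (step P Q)
  then have P: "\<Union>P = H" "disjoint P" "{} \<notin> P"
    and c: "\<And>A e f. A \<in> P \<Longrightarrow> e \<in> A \<Longrightarrow> f \<in> A \<Longrightarrow> (e, f) \<in> (tight_rel t H)\<^sup>*"
    by (auto simp: partition_on_def)
  from step(2) obtain A B e f where AB: "A \<in> P" "B \<in> P" "A \<noteq> B" "e \<in> A" "f \<in> B"
    "card (e \<inter> f) \<ge> t" and Q: "Q = insert (A \<union> B) (P - {A, B})"
    unfolding tight_merge_def by blast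
  have ef: "(e, f) \<in> tight_rel t H"
    using AB P(1) by (auto simp: tight_rel_def)
  have fe: "(f, e) \<in> tight_rel t H"
    using ef sym_tight_rel by (rule symD[rotated])
  have link: "(x, y) \<in> (tight_rel t H)\<^sup>*" "(y, x) \<in> (tight_rel t H)\<^sup>*" if "x \<in> A" "y \<in> B" for x y
    using c[OF AB(1) that(1) AB(4)] c[OF AB(2) AB(5) that(2)] ef
      c[OF AB(1) AB(4) that(1)] c[OF AB(2) that(2) AB(5)] fe
    by (meson rtrancl.rtrancl_into_rtrancl rtrancl_trans)+
  have "disjoint Q"
  proof (rule disjointI)
    fix X Y assume XY: "X \<in> Q" "Y \<in> Q" "X \<noteq> Y"
    have d: "Z \<inter> (A \<union> B) = {}" if "Z \<in> P - {A, B}" for Z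
      using that P(2) AB(1,2) unfolding disjoint_def by blast
    from XY Q d P(2) show "X \<inter> Y = {}"
      unfolding disjoint_def by (metis DiffD1 Int_commute insertE)
  qed
  moreover have "\<Union>Q = H" "{} \<notin> Q" using P AB Q by auto
  ultimately show ?case
    using c link AB Q by (auto simp: partition_on_def)
qed

lemma tight_merge_result_eq:
  assumes "tight_merge_result t H P"
  shows "P = H // tight_equiv t H"
proof -
  from assms have m: "(tight_merge t)\<^sup>*\<^sup>* ((\<lambda>e. {e}) ` H) P" and stop: "\<And>Q. \<not> tight_merge t P Q"
    by (auto simp: tight_merge_result_def)
  from tight_merge_invariant[OF m] have P: "\<Union>P = H" "disjoint P" "{} \<notin> P"
    and c: "\<And>A e f. A \<in> P \<Longrightarrow> e \<in> A \<Longrightarrow> f \<in> A \<Longrightarrow> (e, f) \<in> (tight_rel t H)\<^sup>*"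
    by (auto simp: partition_on_def)
  have closed: "f \<in> A" if "A \<in> P" "(e, f) \<in> (tight_rel t H)\<^sup>*" "e \<in> A" for A e f
    using that(2,1,3)
  proof (induction rule: rtrancl_induct)
    case (step f g)
    from step have f: "f \<in> A" by blast
    from step(2) P(1) obtain B where B: "B \<in> P" "g \<in> B" "card (f \<inter> g) \<ge> t"
      by (auto simp: tight_rel_def)
    have "A = B"
      using stop B f step.prems(1) unfolding tight_merge_def by blast
    with B show ?case by simp
  qed
  have cls: "A = tight_equiv t H `` {e}" if "A \<in> P" "e \<in> A" for A e
  proof (intro equalityI subsetI)
    fix f assume "f \<in> A"
    then have "e \<in> H" "f \<in> H" using that P(1) by blast+
    moreover have "(e, f) \<in> (tight_rel t H)\<^sup>*" using c that \<open>f \<in> A\<close> by blast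
    ultimately show "f \<in> tight_equiv t H `` {e}" by (simp add: tight_equiv_def)
  next
    fix f assume "f \<in> tight_equiv t H `` {e}"
    then have "(e, f) \<in> (tight_rel t H)\<^sup>*" by (simp add: tight_equiv_def)
    with that show "f \<in> A" using closed by blast
  qed
  show ?thesis
  proof (intro equalityI subsetI)
    fix A assume A: "A \<in> P"
    with P(3) obtain e where "e \<in> A" by (metis equals0I)
    moreover from this A P(1) have "e \<in> H" by blast
    ultimately show "A \<in> H // tight_equiv t H"
      using cls[OF A, of e] quotientI[of e H "tight_equiv t H"] by simp
  next
    fix A assume "A \<in> H // tight_equiv t H"
    then obtain e where e: "e \<in> H" "A = tight_equiv t H `` {e}" by (rule quotientE)
    with P(1) obtain B where B: "B \<in> P" "e \<in> B" by blast
    show "A \<in> P" using cls[OF B] e(2) B(1) by simp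
  qed
qed

lemma tight_merge_result_exists:
  assumes "finite H"
  shows "\<exists>P. tight_merge_result t H P"
proof -
  have "\<exists>R. (tight_merge t)\<^sup>*\<^sup>* P R \<and> \<not> (\<exists>Q. tight_merge t R Q)" if "finite P" for P :: "'a set set set"
    using that
  proof (induction "card P" arbitrary: P rule: less_induct)
    case less
    show ?case
    proof (cases "\<exists>Q. tight_merge t P Q")
      case True
      then obtain Q where PQ: "tight_merge t P Q" ..
      then obtain A B where AB: "A \<in> P" "B \<in> P" "A \<noteq> B" "Q = insert (A \<union> B) (P - {A, B})"
        unfolding tight_merge_def by blast
      have "card {A, B} \<le> card P" using AB less.prems by (intro card_mono) auto
      then have "card Q < card P"
        using AB less.prems card_insert_le_m1[of "card P" "P - {A, B}" "A \<union> B"]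
        by (auto simp: card_Diff_subset card_insert_if)
      with less AB PQ show ?thesis
        by (metis converse_rtranclp_into_rtranclp finite_Diff finite_insert)
    qed auto
  qed
  with assms show ?thesis by (simp add: tight_merge_result_def)
qed

lemma tight_merge_result_unique:
  assumes "finite H"
  shows "\<exists>!P. tight_merge_result t H P"
  using tight_merge_result_exists[OF assms] tight_merge_result_eq by blast

lemma tight_components_eq:
  assumes "finite H"
  shows "tight_components t H = H // tight_equiv t H"
  unfolding tight_components_def
  using theI'[OF tight_merge_result_unique[OF assms]] by (rule tight_merge_result_eq)

end

theory Submission imports Defs
begin

text \<open>
  Two estimates of the density of a single monochromatic component carry the proof. Write
  \<open>\<delta>\<^sub>j\<close> for the fraction of all \<open>j\<close>-sets of vertices that lie in the \<open>j\<close>-shadow of a component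
  \<open>C\<close>, so that \<open>\<delta>\<^sub>k\<close> is the density of \<open>C\<close> itself.

  A \<open>t\<close>-set cannot lie in the \<open>t\<close>-shadows of two different \<open>t\<close>-tight components of the same
  colour, since it would merge them. So the \<open>t\<close>-shadows of all components of all colours have
  total size at most \<open>r\<close> times the number of \<open>t\<close>-sets, whereas the components themselves
  partition all \<open>k\<close>-sets. By averaging, some component satisfies \<open>\<delta>\<^sub>k \<ge> \<delta>\<^sub>t / r\<close>
  (\<open>dense_component_exists\<close>).

  The second estimate is a density form of the Kruskal-Katona theorem: \<open>\<delta>\<^sub>j\<close> to the power
  \<open>1 / j\<close> does not increase with \<open>j\<close> (\<open>shadow_density_imp_edge_density\<close>). With
  \<open>\<delta>\<^sub>t = z\<^sup>t\<close> it gives \<open>\<delta>\<^sub>k \<le> z\<^sup>k\<close>, and the first estimate then forces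
  \<open>z\<close> to the power \<open>k - t\<close> to be at least \<open>1 / r\<close>, that is, \<open>z \<ge> y\<close> where \<open>y\<close> is
  \<open>r\<close> to the power \<open>-1 / (k - t)\<close>. Hence \<open>\<delta>\<^sub>k \<ge> z\<^sup>t / r \<ge> y\<^sup>t / r = y\<^sup>k\<close>, and the density inequality between the levels \<open>s\<close> and \<open>k\<close>
  turns this into \<open>\<delta>\<^sub>s \<ge> y\<^sup>s\<close>, which is the claim.
\<close>

section \<open>A density form of the Kruskal-Katona theorem\<close>

lemma binomial_mult_diff:
  assumes "r \<le> n"
  shows "real (Suc r) * real (n choose Suc r) = (real n - real r) * real (n choose r)"
proof -
  have "Suc r * (n choose Suc r) = (n - r) * (n choose r)"
    by (metis binomial_absorb_comp binomial_absorption)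
  then have "real (Suc r) * real (n choose Suc r) = real (n - r) * real (n choose r)"
    by (metis of_nat_mult)
  with assms show ?thesis by (simp only: of_nat_diff)
qed

lemma incidence_count:
  assumes "finite V" "finite A" "\<And>a. a \<in> A \<Longrightarrow> a \<subseteq> V \<and> card a = m"
  shows "(\<Sum>v\<in>V. real (card {a \<in> A. v \<in> a})) = real m * real (card A)"
proof -
  have "(\<Sum>v\<in>V. card {a \<in> A. v \<in> a}) = m * card A"
  proof (rule sum_multicount)
    show "\<forall>a\<in>A. card {v \<in> V. v \<in> a} = m"
    proof
      fix a assume "a \<in> A"
      with assms(3) have "{v \<in> V. v \<in> a} = a" "card a = m" by auto
      then show "card {v \<in> V. v \<in> a} = m" by simp
    qed
  qed (use assms in auto)
  then show ?thesis by (metis of_nat_mult of_nat_sum)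
qed

text \<open>
  The argument is Keevash's proof of Lovasz's form of the Kruskal-Katona theorem, with the
  generalized binomial coefficient replaced by a power of \<open>y\<close>. Every vertex \<open>v\<close> satisfies
  \<open>r * K v \<le> y * (n - r) * d v\<close>, where \<open>K v\<close> and \<open>d v\<close> are its degrees in \<open>A\<close> and in \<open>G\<close>. If
  \<open>d v\<close> is small, this is the induction hypothesis in the link of \<open>v\<close>. If \<open>d v\<close> is large, it
  holds because the edges of \<open>A\<close> through \<open>v\<close> inject into the members of \<open>G\<close> that avoid \<open>v\<close>,
  of which few are left. Summing over \<open>v\<close> gives the result.
\<close>

lemma kruskal_katona_density_step:
  fixes y :: real
  assumes "finite V" "r > 0"
    and "\<And>a. a \<in> A \<Longrightarrow> a \<subseteq> V \<and> card a = Suc r"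
    and "\<And>g. g \<in> G \<Longrightarrow> g \<subseteq> V \<and> card g = r"
    and "\<And>a x. a \<in> A \<Longrightarrow> x \<in> a \<Longrightarrow> a - {x} \<in> G"
    and "0 \<le> y" "y \<le> 1" "real (card G) \<le> y ^ r * real (card V choose r)"
  shows "real (card A) \<le> y ^ Suc r * real (card V choose Suc r)"
  using assms
proof (induction r arbitrary: V A G y)
  case 0
  then show ?case by simp
next
  case (Suc q)
  let ?r = "Suc q" and ?n = "card V"
  note V = Suc.prems(1) and A = Suc.prems(3) and G = Suc.prems(4) and sub = Suc.prems(5)
    and y = Suc.prems(6,7) and cardG = Suc.prems(8)
  have finA: "finite A" and finG: "finite G"
    using A G V by (auto intro!: finite_subset[of _ "Pow V"])
  define K where "K v = card {a \<in> A. v \<in> a}" for v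
  define d where "d v = card {g \<in> G. v \<in> g}" for v
  show ?case
  proof (cases "A = {}")
    case True
    then show ?thesis using y by simp
  next
    case False
    then obtain a0 where a0: "a0 \<in> A" by blast
    then have n: "Suc ?r \<le> ?n" using A[OF a0] card_mono[OF V, of a0] by simp
    have deg: "real ?r * real (K v) \<le> y * (real ?n - real ?r) * real (d v)" if v: "v \<in> V" for v
    proof -
      have cardV': "card (V - {v}) = ?n - 1" using v V by simp
      define A' where "A' = (\<lambda>a. a - {v}) ` {a \<in> A. v \<in> a}"
      define G' where "G' = (\<lambda>a. a - {v}) ` {g \<in> G. v \<in> g}"
      have inj: "inj_on (\<lambda>a. a - {v}) {a \<in> B. v \<in> a}" for B
        by (rule inj_onI) (auto dest: equalityD1 equalityD2)
      have cA': "card A' = K v" unfolding A'_def K_def by (rule card_image[OF inj])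
      have cG': "card G' = d v" unfolding G'_def d_def by (rule card_image[OF inj])
      have K_le: "K v + d v \<le> card G"
      proof -
        have "A' \<subseteq> {g \<in> G. v \<notin> g}" unfolding A'_def using sub by auto
        then have "card A' \<le> card {g \<in> G. v \<notin> g}" using finG by (intro card_mono) auto
        moreover have "card ({g \<in> G. v \<notin> g} \<union> {g \<in> G. v \<in> g}) = card {g \<in> G. v \<notin> g} + d v"
          unfolding d_def using finG by (intro card_Un_disjoint) auto
        moreover have "{g \<in> G. v \<notin> g} \<union> {g \<in> G. v \<in> g} = G" by blast
        ultimately show ?thesis using cA' by simp
      qed
      let ?B = "real ((?n - 1) choose q)"
      have Bpos: "?B > 0" using n by simp
      have absorb: "real ?r * real (?n choose ?r) = real ?n * ?B"
        by (metis binomial_absorption of_nat_mult)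
      \<comment> \<open>The induction hypothesis is available for \<open>q > 0\<close> only. For \<open>q = 0\<close>, \<open>d v\<close> is
        \<open>0\<close> or \<open>1\<close>, and \<open>1\<close> already counts as large.\<close>
      consider "q = 0" "d v = 0" | "q > 0" "real (d v) \<le> y ^ q * ?B" | "y ^ q * ?B \<le> real (d v)"
      proof (cases "q = 0")
        case True
        then have "y ^ q * ?B = 1" by simp
        then show thesis using that True by (cases "d v = 0") auto
      next
        case False
        then show thesis using that by (cases "real (d v) \<le> y ^ q * ?B") auto
      qed
      then show ?thesis
      proof cases
        case 1
        have "{a \<in> A. v \<in> a} = {}"
        proof (rule ccontr)
          assume "{a \<in> A. v \<in> a} \<noteq> {}"
          then obtain a where a: "a \<in> A" "v \<in> a" by blast
          have "\<not> a \<subseteq> {v}" using A[OF a(1)] card_mono[of "{v}" a] by auto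
          then obtain x where "x \<in> a" "x \<noteq> v" by blast
          with a sub have "a - {x} \<in> {g \<in> G. v \<in> g}" by auto
          with 1 finG show False unfolding d_def by auto
        qed
        then have "K v = 0" unfolding K_def by (simp only: card.empty)
        then show ?thesis using 1 by simp
      next
        case 2
        \<comment> \<open>In the link of \<open>v\<close> the hypothesis is applied with the exact density \<open>z ^ q\<close> in place
          of \<open>y ^ q\<close>: one factor \<open>z\<close> is then bounded by \<open>y\<close> and the others restore \<open>d v\<close>.\<close>
        define z where "z = root q (real (d v) / ?B)"
        have z0: "z \<ge> 0" unfolding z_def by (intro real_root_ge_zero) simp
        have zq: "z ^ q * ?B = real (d v)" unfolding z_def using Bpos 2(1) by (simp add: real_root_pow_pos2)
        have "z ^ q \<le> y ^ q" using 2 zq Bpos by (metis mult_le_cancel_right_pos)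
        then have zy: "z \<le> y" using z0 y 2(1) by (metis power_mono_iff)
        have "real (card A') \<le> z ^ Suc q * real (card (V - {v}) choose Suc q)"
        proof (rule Suc.IH)
          show "finite (V - {v})" "q > 0" "0 \<le> z" "z \<le> 1" using V 2 z0 zy y by auto
          show "a \<subseteq> V - {v} \<and> card a = Suc q" if "a \<in> A'" for a
            using that A unfolding A'_def by auto
          show "g \<subseteq> V - {v} \<and> card g = q" if "g \<in> G'" for g
            using that G unfolding G'_def by auto
          show "a - {x} \<in> G'" if "a \<in> A'" "x \<in> a" for a x
          proof -
            from that obtain b where b: "b \<in> A" "v \<in> b" "a = b - {v}" unfolding A'_def by blast
            with that have x: "x \<in> b" "x \<noteq> v" by auto
            then have "b - {x} \<in> {g \<in> G. v \<in> g}" using b sub by auto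
            moreover have "a - {x} = (b - {x}) - {v}" using b by auto
            ultimately show ?thesis unfolding G'_def by blast
          qed
          show "real (card G') \<le> z ^ q * real (card (V - {v}) choose q)"
            using zq cG' cardV' by simp
        qed
        then have "real ?r * real (K v) \<le> real ?r * (z ^ Suc q * real ((?n - 1) choose ?r))"
          using cA' cardV' by (intro mult_left_mono) auto
        also have "\<dots> = z ^ ?r * (real ?r * real ((?n - 1) choose ?r))" by simp
        also have "\<dots> = z ^ ?r * ((real (?n - 1) - real q) * ?B)"
          using binomial_mult_diff[of q "?n - 1"] n by simp
        also have "real (?n - 1) - real q = real ?n - real ?r" using n by (simp add: of_nat_diff)
        also have "z ^ ?r * ((real ?n - real ?r) * ?B) = z * ((real ?n - real ?r) * real (d v))"
          using zq by (simp add: algebra_simps flip: zq)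
        also have "\<dots> \<le> y * ((real ?n - real ?r) * real (d v))"
          using zy n by (intro mult_right_mono) auto
        finally show ?thesis by (simp only: mult.assoc)
      next
        case 3
        have "real ?r * real (K v) \<le> real ?r * (real (card G) - real (d v))"
          using K_le by (intro mult_left_mono) auto
        also have "\<dots> \<le> real ?r * (y ^ ?r * real (?n choose ?r)) - real ?r * real (d v)"
          unfolding right_diff_distrib by (intro diff_right_mono mult_left_mono cardG) auto
        also have "\<dots> = y * real ?n * (y ^ q * ?B) - real ?r * real (d v)"
          using arg_cong[OF absorb, of "\<lambda>x. y ^ ?r * x"] by (simp only: power_Suc mult_ac)
        also have "\<dots> \<le> y * real ?n * real (d v) - real ?r * real (d v)"
          using 3 y by (intro diff_right_mono mult_left_mono) auto
        \<comment> \<open>By \<open>y \<le> 1\<close>, the loss \<open>r * d v\<close> is at least \<open>y\<close> times itself.\<close>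
        also have "\<dots> \<le> y * real ?n * real (d v) - y * (real ?r * real (d v))"
          using y mult_right_mono[of y 1 "real ?r * real (d v)"] by simp
        finally show ?thesis by (simp only: algebra_simps)
      qed
    qed
    have "real ?r * (real (Suc ?r) * real (card A)) = (\<Sum>v\<in>V. real ?r * real (K v))"
      using incidence_count[OF V finA A] by (simp only: K_def flip: sum_distrib_left)
    also have "\<dots> \<le> (\<Sum>v\<in>V. y * (real ?n - real ?r) * real (d v))"
      using deg by (rule sum_mono)
    also have "\<dots> = y * (real ?n - real ?r) * (real ?r * real (card G))"
      using incidence_count[OF V finG G] by (simp only: d_def flip: sum_distrib_left)
    also have "\<dots> \<le> y * (real ?n - real ?r) * (real ?r * (y ^ ?r * real (?n choose ?r)))"
      using y n by (intro mult_left_mono cardG) auto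
    also have "\<dots> = real ?r * (y ^ Suc ?r * ((real ?n - real ?r) * real (?n choose ?r)))"
      by (simp only: power_Suc mult_ac)
    also have "\<dots> = real ?r * (y ^ Suc ?r * (real (Suc ?r) * real (?n choose Suc ?r)))"
      using binomial_mult_diff[of ?r ?n] n by simp
    also have "\<dots> = real ?r * (real (Suc ?r) * (y ^ Suc ?r * real (?n choose Suc ?r)))"
      by (simp only: mult_ac)
    finally show ?thesis by (simp only: mult_le_cancel_left_pos of_nat_0_less_iff zero_less_Suc)
  qed
qed

lemma shadow_subset:
  assumes "\<And>e. e \<in> C \<Longrightarrow> e \<subseteq> V"
  shows "shadow j C \<subseteq> {S. S \<subseteq> V \<and> card S = j}"
  using assms unfolding shadow_def by auto

lemma card_shadow_le:
  assumes "finite V" "\<And>e. e \<in> C \<Longrightarrow> e \<subseteq> V"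
  shows "card (shadow j C) \<le> card V choose j"
proof -
  have "card (shadow j C) \<le> card {S. S \<subseteq> V \<and> card S = j}"
    using assms by (intro card_mono shadow_subset) auto
  then show ?thesis using assms(1) by (simp only: n_subsets)
qed

lemma shadow_uniform:
  assumes "\<And>e. e \<in> C \<Longrightarrow> finite e \<and> card e = k"
  shows "shadow k C = C"
proof (intro equalityI subsetI)
  fix S assume "S \<in> shadow k C"
  then obtain e where e: "e \<in> C" "S \<subseteq> e" "card S = k" unfolding shadow_def by auto
  with assms[OF e(1)] have "S = e" by (intro card_subset_eq) auto
  with e show "S \<in> C" by simp
qed (use assms in \<open>auto simp: shadow_def\<close>)

text \<open>Two consecutive shadows of \<open>C\<close> can serve as \<open>A\<close> and \<open>G\<close> in
  \<open>kruskal_katona_density_step\<close>. Its conclusion has the form of its hypothesis with the same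
  \<open>y\<close>, so it can be iterated from level \<open>s\<close> up to level \<open>k\<close>.\<close>

lemma shadow_density_imp_edge_density:
  fixes y :: real
  assumes V: "finite V" and C: "\<And>e. e \<in> C \<Longrightarrow> e \<subseteq> V \<and> card e = k"
    and s: "0 < s" "s \<le> k" and y: "0 \<le> y" "y \<le> 1"
    and le: "real (card (shadow s C)) \<le> y ^ s * real (card V choose s)"
  shows "real (card C) \<le> y ^ k * real (card V choose k)"
proof -
  have "real (card (shadow k C)) \<le> y ^ k * real (card V choose k)"
    using s(2)
  proof (induction k rule: dec_induct)
    case base
    show ?case by (rule le)
  next
    case (step j)
    show ?case
    proof (rule kruskal_katona_density_step[OF V _ _ _ _ y step.IH])
      show "j > 0" using s step by simp
      show "a \<subseteq> V \<and> card a = Suc j" if "a \<in> shadow (Suc j) C" for a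
        using that C shadow_subset[of C V] by blast
      show "g \<subseteq> V \<and> card g = j" if "g \<in> shadow j C" for g
        using that C shadow_subset[of C V] by blast
      show "a - {x} \<in> shadow j C" if "a \<in> shadow (Suc j) C" "x \<in> a" for a x
        using that unfolding shadow_def by auto
    qed
  qed
  moreover have "shadow k C = C"
    using C V by (intro shadow_uniform) (auto intro: finite_subset)
  ultimately show ?thesis by simp
qed

text \<open>
  Replacing a density \<open>\<delta>\<^sub>j\<close> by its \<open>j\<close>-th root \<open>z\<close> makes levels comparable: all later
  estimates compare such roots with one fixed number. It is used for \<open>j = t\<close> and for \<open>j = s\<close>.
\<close>

lemma shadow_density_root:
  assumes V: "finite V" and C: "\<And>e. e \<in> C \<Longrightarrow> e \<subseteq> V \<and> card e = k"
    and j: "0 < j" "j \<le> k" and k: "k \<le> card V"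
  obtains z :: real where "0 \<le> z"
    "real (card (shadow j C)) = z ^ j * real (card V choose j)"
    "real (card C) \<le> z ^ k * real (card V choose k)"
proof -
  have B: "real (card V choose j) > 0" using j k by simp
  define z where "z = root j (real (card (shadow j C)) / real (card V choose j))"
  have z: "0 \<le> z" "real (card (shadow j C)) = z ^ j * real (card V choose j)"
    unfolding z_def using B j by simp_all
  have "card (shadow j C) \<le> card V choose j" using V C by (intro card_shadow_le) auto
  then have "z \<le> 1" unfolding z_def using B j by simp
  with z have "real (card C) \<le> z ^ k * real (card V choose k)"
    using shadow_density_imp_edge_density[OF V C j] by simp
  with z show thesis by (rule that)
qed

text \<open>
  The hypothesis \<open>dense\<close> is \<open>\<delta>\<^sub>k \<ge> \<delta>\<^sub>t / r\<close> with denominators cleared. The bound on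
  \<open>\<delta>\<^sub>s\<close> goes through \<open>\<delta>\<^sub>k\<close>: level \<open>t\<close> against level \<open>k\<close> gives \<open>\<delta>\<^sub>k \<ge> y ^ k\<close>, and
  level \<open>s\<close> against level \<open>k\<close> brings it down, so \<open>s\<close> and \<open>t\<close> may be in either order.
\<close>

lemma dense_component_large_shadow:
  assumes V: "finite V" and C: "\<And>e. e \<in> C \<Longrightarrow> e \<subseteq> V \<and> card e = k" and ne: "C \<noteq> {}"
    and pos: "0 < t" "t < k" "0 < s" "s \<le> k" "k \<le> card V" "0 < r"
    and dense: "card (shadow t C) * (card V choose k) \<le> card C * (r * (card V choose t))"
  shows "real r powr (- (real s / (real k - real t))) * real (card V choose s)
    \<le> real (card (shadow s C))"
proof -
  define y where "y = real r powr (- (1 / (real k - real t)))"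
  have y0: "y > 0" unfolding y_def using pos by simp
  have ypow: "y ^ m = real r powr (- (real m / (real k - real t)))" for m
    unfolding y_def using pos by (simp add: powr_powr flip: powr_realpow)
  have "y ^ (k - t) = real r powr (- 1)"
    unfolding ypow using pos by (simp add: of_nat_diff)
  then have ykt: "real r * y ^ (k - t) = 1" using pos by (simp add: powr_minus)
  have Bk: "real (card V choose k) > 0" and Bt: "real (card V choose t) > 0" using pos by auto
  have "finite C" using C V by (auto intro!: finite_subset[of _ "Pow V"])
  with ne have Cpos: "real (card C) > 0" by (simp add: card_gt_0_iff)
  obtain z where z: "0 \<le> z" "real (card (shadow t C)) = z ^ t * real (card V choose t)"
    "real (card C) \<le> z ^ k * real (card V choose k)"
    using shadow_density_root[OF V C] pos by (metis less_imp_le)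
  have "z \<noteq> 0" using z(3) Cpos pos by (auto simp: power_0_left)
  with z have zpos: "z > 0" by simp
  have "real (card (shadow t C) * (card V choose k)) \<le> real (card C * (r * (card V choose t)))"
    using dense by (simp only: of_nat_le_iff)
  then have "(z ^ t * real (card V choose k)) * real (card V choose t)
      \<le> (real r * real (card C)) * real (card V choose t)"
    unfolding of_nat_mult z(2) by (simp only: mult_ac)
  then have zC: "z ^ t * real (card V choose k) \<le> real r * real (card C)"
    using Bt by (simp only: mult_le_cancel_right_pos)
  also have "\<dots> \<le> real r * (z ^ k * real (card V choose k))"
    using z(3) by (intro mult_left_mono) auto
  finally have "z ^ t \<le> real r * z ^ k"
    using Bk by (simp only: mult.assoc[symmetric] mult_le_cancel_right_pos)
  also have "z ^ k = z ^ t * z ^ (k - t)" using pos by (simp flip: power_add)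
  finally have "1 \<le> real r * z ^ (k - t)" using zpos by (simp add: mult.left_commute)
  then have "y ^ (k - t) \<le> z ^ (k - t)" using ykt pos
    by (metis mult_le_cancel_left_pos of_nat_0_less_iff)
  then have "y \<le> z" using y0 zpos pos by simp
  then have "real r * (y ^ k * real (card V choose k)) \<le> z ^ t * real (card V choose k)"
  proof -
    have "real r * y ^ k = y ^ t * (real r * y ^ (k - t))"
      using pos by (simp add: mult.left_commute flip: power_add)
    also have "\<dots> \<le> z ^ t" using ykt \<open>y \<le> z\<close> y0 by (simp add: power_mono)
    finally show ?thesis using Bk by (simp flip: mult.assoc)
  qed
  with zC have "real r * (y ^ k * real (card V choose k)) \<le> real r * real (card C)" by linarith
  then have edge: "y ^ k * real (card V choose k) \<le> real (card C)" using pos by simp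
  obtain w where w: "0 \<le> w" "real (card (shadow s C)) = w ^ s * real (card V choose s)"
    "real (card C) \<le> w ^ k * real (card V choose k)"
    using shadow_density_root[OF V C] pos by metis
  have "y ^ k * real (card V choose k) \<le> w ^ k * real (card V choose k)" using edge w(3) by linarith
  then have "y ^ k \<le> w ^ k" using Bk by simp
  then have "y \<le> w" using y0 w(1) pos by simp
  then have "y ^ s * real (card V choose s) \<le> w ^ s * real (card V choose s)"
    using y0 by (intro mult_right_mono power_mono) auto
  then show ?thesis unfolding w(2) ypow .
qed

section \<open>Averaging over the monochromatic components\<close>

lemma tight_components_partition:
  assumes "finite H"
  shows "partition_on H (tight_components t H)"
  unfolding tight_components_eq[OF assms] by (rule partition_on_quotient[OF equiv_tight_equiv])

text \<open>Two edges that share a \<open>t\<close>-set are merged, so every \<open>t\<close>-set selects one component.\<close>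

lemma shadows_of_tight_components_disjoint:
  assumes H: "finite H" "\<And>e. e \<in> H \<Longrightarrow> finite e"
    and CD: "C \<in> tight_components t H" "D \<in> tight_components t H" "C \<noteq> D"
  shows "shadow t C \<inter> shadow t D = {}"
proof (rule ccontr)
  assume "shadow t C \<inter> shadow t D \<noteq> {}"
  then obtain S e f where S: "card S = t" "e \<in> C" "S \<subseteq> e" "f \<in> D" "S \<subseteq> f"
    unfolding shadow_def by blast
  note CD' = CD(1,2)[unfolded tight_components_eq[OF H(1)]]
  have ef: "e \<in> H" "f \<in> H"
    using S CD(1,2) tight_components_partition[OF H(1), of t] by (auto simp: partition_on_def)
  have "card S \<le> card (e \<inter> f)" using S H(2)[OF ef(1)] by (intro card_mono) auto
  then have "(e, f) \<in> tight_rel t H" using S ef by (simp add: tight_rel_def)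
  then have "(e, f) \<in> tight_equiv t H" using ef by (auto simp: tight_equiv_def)
  then have "C = D"
    using quotient_eq_iff[OF equiv_tight_equiv CD' S(2,4)] by simp
  with CD show False by simp
qed

lemma sum_card_shadows_le:
  assumes V: "finite V" and H: "\<And>e. e \<in> H \<Longrightarrow> e \<subseteq> V"
  shows "(\<Sum>C\<in>tight_components t H. card (shadow t C)) \<le> card V choose t"
proof -
  have finH: "finite H" using H V by (auto intro!: finite_subset[of _ "Pow V"])
  have finT: "finite (tight_components t H)"
    using finite_elements[OF finH tight_components_partition[OF finH]] .
  have sub: "shadow t C \<subseteq> {S. S \<subseteq> V \<and> card S = t}" if "C \<in> tight_components t H" for C
    using that H partition_onD1[OF tight_components_partition[OF finH, of t]]
    by (intro shadow_subset) blast
  have fin: "finite {S. S \<subseteq> V \<and> card S = t}" using V by simp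
  have "(\<Sum>C\<in>tight_components t H. card (shadow t C))
      = card (\<Union>C\<in>tight_components t H. shadow t C)"
  proof (rule card_UN_disjoint[symmetric, OF finT])
    show "\<forall>C\<in>tight_components t H. finite (shadow t C)"
      using sub fin by (metis finite_subset)
    show "\<forall>C\<in>tight_components t H. \<forall>D\<in>tight_components t H. C \<noteq> D \<longrightarrow> shadow t C \<inter> shadow t D = {}"
      using shadows_of_tight_components_disjoint[OF finH] H V by (metis finite_subset)
  qed
  also have "\<dots> \<le> card {S. S \<subseteq> V \<and> card S = t}" using sub by (intro card_mono[OF fin] UN_least)
  also have "\<dots> = card V choose t" using V by (rule n_subsets)
  finally show ?thesis .
qed

lemma sum_card_tight_components:
  assumes "finite H" "\<And>e. e \<in> H \<Longrightarrow> finite e"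
  shows "(\<Sum>C\<in>tight_components t H. card C) = card H"
proof -
  note P = tight_components_partition[OF assms(1), of t]
  have "card (\<Union>(tight_components t H)) = (\<Sum>C\<in>tight_components t H. card C)"
    using partition_onD2[OF P] partition_onD1[OF P] assms(1)
    by (intro card_Union_disjoint) (auto simp: disjoint_def pairwise_def disjnt_def intro: finite_subset)
  then show ?thesis using partition_onD1[OF P] by simp
qed

text \<open>
  Over all components of all colours, the sizes add up to the number of \<open>k\<close>-sets and the
  \<open>t\<close>-shadows to at most \<open>r\<close> times the number of \<open>t\<close>-sets, so the ratio of the two cannot
  lie below the ratio of these totals everywhere.
\<close>

lemma dense_component_exists:
  assumes r: "0 < r" and k: "k \<le> n" and c: "c \<in> edge_colorings r (complete_hypergraph n k)"
  obtains i C where "i \<in> {1..r}" "C \<in> tight_components t (color_class (complete_hypergraph n k) c i)"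
    "card (shadow t C) * (n choose k) \<le> card C * (r * (n choose t))"
proof -
  let ?E = "complete_hypergraph n k"
  let ?H = "color_class ?E c" and ?T = "\<lambda>i. tight_components t (color_class ?E c i)"
  let ?I = "SIGMA i:{1..r}. ?T i"
  have finE: "finite ?E" unfolding complete_hypergraph_def by simp
  have cardE: "card ?E = n choose k"
    unfolding complete_hypergraph_def using n_subsets[of "{1..n}" k] by simp
  have H: "finite (?H i)" "\<And>e. e \<in> ?H i \<Longrightarrow> e \<subseteq> {1..n}" for i
    using finE by (auto simp: color_class_def complete_hypergraph_def)
  then have He: "\<And>e. e \<in> ?H i \<Longrightarrow> finite e" for i by (meson finite_atLeastAtMost finite_subset)
  have finT: "finite (?T i)" for i
    using finite_elements[OF H(1) tight_components_partition[OF H(1)]] .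
  have edges: "(\<Sum>(i, C)\<in>?I. card C) = n choose k"
  proof -
    have "(\<Sum>(i, C)\<in>?I. card C) = (\<Sum>i\<in>{1..r}. \<Sum>C\<in>?T i. card C)"
      using finT by (subst sum.Sigma) auto
    also have "\<dots> = (\<Sum>i\<in>{1..r}. card (?H i))"
      using sum_card_tight_components[OF H(1) He] by simp
    also have "\<dots> = card (\<Union>i\<in>{1..r}. ?H i)"
      using H(1) by (intro card_UN_disjoint[symmetric]) (auto simp: color_class_def)
    also have "(\<Union>i\<in>{1..r}. ?H i) = ?E"
      using c by (auto simp: color_class_def edge_colorings_def PiE_def Pi_def)
    finally show ?thesis using cardE by simp
  qed
  have shadows: "(\<Sum>(i, C)\<in>?I. card (shadow t C)) \<le> r * (n choose t)"
  proof -
    have "(\<Sum>(i, C)\<in>?I. card (shadow t C)) = (\<Sum>i\<in>{1..r}. \<Sum>C\<in>?T i. card (shadow t C))"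
      using finT by (subst sum.Sigma) auto
    also have "\<dots> \<le> (\<Sum>i\<in>{1..r}. n choose t)"
      using sum_card_shadows_le[OF finite_atLeastAtMost H(2)] by (intro sum_mono) simp
    finally show ?thesis by simp
  qed
  have "\<exists>(i, C)\<in>?I. card (shadow t C) * (n choose k) \<le> card C * (r * (n choose t))"
  proof (rule ccontr)
    assume "\<not> ?thesis"
    then have lt: "card C * (r * (n choose t)) < card (shadow t C) * (n choose k)"
      if "(i, C) \<in> ?I" for i C using that by fastforce
    have ne: "?I \<noteq> {}"
    proof
      assume "?I = {}"
      then have "(\<Sum>(i, C)\<in>?I. card C) = 0" by (simp only: sum.empty)
      with edges k show False by simp
    qed
    have "(n choose k) * (r * (n choose t)) = (\<Sum>(i, C)\<in>?I. card C * (r * (n choose t)))"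
      unfolding edges[symmetric] sum_distrib_right by (simp only: case_prod_unfold)
    also have "\<dots> < (\<Sum>(i, C)\<in>?I. card (shadow t C) * (n choose k))"
      using finT ne lt by (intro sum_strict_mono) auto
    also have "\<dots> = (\<Sum>(i, C)\<in>?I. card (shadow t C)) * (n choose k)"
      unfolding sum_distrib_right by (simp only: case_prod_unfold)
    also have "\<dots> \<le> (r * (n choose t)) * (n choose k)" using shadows by (rule mult_right_mono) simp
    finally show False by simp
  qed
  then show thesis using that by auto
qed

lemma M_coloring_ge:
  assumes i: "i \<in> {1..r}" and C: "C \<in> tight_components t (color_class (complete_hypergraph n k) c i)"
  shows "card (shadow s C) \<le> M_coloring n r k t s c"
proof -
  let ?H = "color_class (complete_hypergraph n k) c"
  have finH: "finite (?H j)" for j by (simp add: color_class_def complete_hypergraph_def)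
  note P = tight_components_partition[OF finH, where t = t]
  have fin: "finite (tight_components t (?H j))" for j
    using finite_elements[OF finH P] .
  have ne: "?H i \<noteq> {}" using C partition_onD1[OF P[of i]] partition_onD3[OF P[of i]] by auto
  have "card (shadow s C) \<le> (MAX C \<in> tight_components t (?H i). card (shadow s C))"
    using C fin by (intro Max_ge) auto
  also have "\<dots> \<le> M_coloring n r k t s c"
    unfolding M_coloring_def using i ne by (intro Max_ge) auto
  finally show ?thesis .
qed

lemma M_min_attained:
  assumes "0 < r"
  obtains c where "c \<in> edge_colorings r (complete_hypergraph n k)"
    "M_min n r k t s = M_coloring n r k t s c"
proof -
  have fin: "finite (edge_colorings r (complete_hypergraph n k))"
    unfolding edge_colorings_def complete_hypergraph_def by (intro finite_PiE) auto
  have "edge_colorings r (complete_hypergraph n k) \<noteq> {}"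
    unfolding edge_colorings_def using assms by (simp add: PiE_eq_empty_iff)
  with fin have "M_min n r k t s \<in> M_coloring n r k t s ` edge_colorings r (complete_hypergraph n k)"
    unfolding M_min_def by (intro Min_in) auto
  then show thesis using that by auto
qed

theorem theorem1p1:
  fixes k t s r n :: nat
  assumes "k > 0" and "t > 0" and "s > 0" and "r > 0" and "n > 0"
    and "max (t + 1) s \<le> k" and "k \<le> n"
  shows "real (M_min n r k t s) \<ge> real r powr (- (real s / (real k - real t))) * real (n choose s)"
proof -
  obtain c where c: "c \<in> edge_colorings r (complete_hypergraph n k)"
    "M_min n r k t s = M_coloring n r k t s c"
    using M_min_attained[OF assms(4)] .
  obtain i C where iC: "i \<in> {1..r}" "C \<in> tight_components t (color_class (complete_hypergraph n k) c i)"
    and dense: "card (shadow t C) * (n choose k) \<le> card C * (r * (n choose t))"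
    using dense_component_exists[OF assms(4,7) c(1)] .
  have "finite (color_class (complete_hypergraph n k) c i)"
    by (simp add: color_class_def complete_hypergraph_def)
  note P = tight_components_partition[OF this, of t]
  have C: "e \<subseteq> {1..n} \<and> card e = k" if "e \<in> C" for e
    using that iC(2) partition_onD1[OF P] by (auto simp: color_class_def complete_hypergraph_def)
  have ne: "C \<noteq> {}" using iC(2) partition_onD3[OF P] by auto
  have "real r powr (- (real s / (real k - real t))) * real (n choose s) \<le> real (card (shadow s C))"
    using dense_component_large_shadow[OF finite_atLeastAtMost C ne, of t s r] assms dense by simp
  also have "\<dots> \<le> real (M_min n r k t s)" using M_coloring_ge[OF iC, of s] c(2) by simp
  finally show ?thesis .
qed

end
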